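(* Let $G=(V,E)$ be a graph and let $v \in V$. Suppose that all vertices of $G$, except possibly $v$, have degree at most $\Delta$, where $\Delta$ is a positive integer. Then for any $x \in \mathbb{C}$ with $|x| \leq \frac{1}{2\Delta}$, we have $Z_G(x) \neq 0$.
   Context: The forest generating function of a graph $G=(V,E)$ is $Z_G(x)=\sum_{F\subseteq E:\ (V,F)\text{ is a forest}} x^{|F|}$. *)

theory Defs
  imports Complex_Main
begin

definition simple_graph :: "'a set \<Rightarrow> 'a set set \<Rightarrow> bool" where
  "simple_graph V E \<longleftrightarrow> finite V \<and> (\<forall>e\<in>E. e \<subseteq> V \<and> card e = 2)"

definition degree :: "'a set set \<Rightarrow> 'a \<Rightarrow> nat" where
  "degree E u = card {e \<in> E. u \<in> e}"

text \<open>A cycle is given by the list of its vertices, in cyclic order and without repeating the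
  starting vertex.\<close>

definition is_cycle :: "'a set set \<Rightarrow> 'a list \<Rightarrow> bool" where
  "is_cycle E c \<longleftrightarrow> length c \<ge> 3 \<and> distinct c \<and>
     (\<forall>i<length c. {c ! i, c ! (Suc i mod length c)} \<in> E)"

definition forest :: "'a set \<Rightarrow> 'a set set \<Rightarrow> bool" where
  "forest V F \<longleftrightarrow> simple_graph V F \<and> (\<nexists>c. is_cycle F c)"

definition forest_gf :: "'a set \<Rightarrow> 'a set set \<Rightarrow> complex \<Rightarrow> complex" where
  "forest_gf V E x = (\<Sum>F | F \<subseteq> E \<and> forest V F. x ^ card F)"

end

theory Submission
  imports Defs
begin

text \<open>
  For a set \<open>S\<close> of vertices containing \<open>v\<close>, let \<open>N S\<close> be the generating function of the forests in
  which the vertices of \<open>S\<close> lie in different components (the forests of \<open>G\<close> with \<open>S\<close> contracted), and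
  for \<open>T \<subseteq> S\<close> let \<open>P w T S\<close> be the part of \<open>N S\<close> in which \<open>w\<close> is connected to \<open>T\<close>. If \<open>u\<close> lies outside
  \<open>S\<close>, then \<open>N S = N (S \<union> {u}) + P u S S\<close>, and removing the first edge of the path from \<open>u\<close> to \<open>T\<close>
  gives \<open>P u T S = x * (\<Sum>w. P w T (S \<union> {u}))\<close>, summed over the neighbours \<open>w\<close> of \<open>u\<close>. By induction
  on the number of vertices outside \<open>S\<close> one has \<open>N S \<noteq> 0\<close> and \<open>\<bar>P w T S\<bar> \<le> \<bar>N S\<bar>\<close>: the
  second identity bounds \<open>\<bar>P u T S\<bar>\<close> by \<open>\<Delta> \<bar>x\<bar> \<bar>N (S \<union> {u})\<bar> \<le> \<bar>N (S \<union> {u})\<bar> / 2\<close>, so the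
  first one gives \<open>\<bar>N S\<bar> \<ge> \<bar>N (S \<union> {u})\<bar> / 2\<close>.
\<close>

section \<open>Connectivity in forests\<close>

definition conn :: "'a set set \<Rightarrow> 'a \<Rightarrow> 'a \<Rightarrow> bool" where
  "conn F = (\<lambda>a b. {a, b} \<in> F)\<^sup>*\<^sup>*"

lemma conn_refl [simp]: "conn F a a"
  by (simp add: conn_def)

lemma conn_trans: "conn F a b \<Longrightarrow> conn F b c \<Longrightarrow> conn F a c"
  by (simp add: conn_def)

lemma conn_edge: "{a, b} \<in> F \<Longrightarrow> conn F a b"
  by (auto simp: conn_def)

lemma conn_sym: "conn F a b \<Longrightarrow> conn F b a"
  unfolding conn_def
  by (rule sympD[OF symp_rtranclp]) (auto simp: symp_def insert_commute)

lemma conn_mono: "conn F a b \<Longrightarrow> F \<subseteq> F' \<Longrightarrow> conn F' a b"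
  unfolding conn_def by (erule rtranclp_mono[THEN predicate2D, rotated]) auto

text \<open>Cut a walk at its first and last use of the new edge: either the two cuts are at the
  same endpoint and the edge can be bypassed, or they are at different ones.\<close>

lemma conn_insert:
  assumes "conn (insert {p, q} F) a b"
  shows "conn F a b \<or> conn F a p \<and> conn F q b \<or> conn F a q \<and> conn F p b"
  using assms unfolding conn_def[of "insert _ _"]
proof (induction rule: rtranclp_induct)
  case base
  then show ?case by simp
next
  case (step b c)
  show ?case
  proof (cases "{b, c} \<in> F")
    case True
    then show ?thesis using step.IH conn_trans[OF _ conn_edge[OF True]] by blast
  next
    case False
    then have "b = p \<and> c = q \<or> b = q \<and> c = p"
      using step.hyps by (auto simp: doubleton_eq_iff)
    then show ?thesis using step.IH by auto
  qed
qed

text \<open>Cut the walk at its last visit to \<open>u\<close>. The induction does this by starting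
  afresh whenever the walk is at \<open>u\<close>.\<close>

lemma conn_first_edge:
  assumes "conn F u t" "u \<noteq> t"
  obtains w where "{u, w} \<in> F" "conn (F - {{u, w}}) w t"
proof -
  have "u = t \<or> (\<exists>w. {u, w} \<in> F \<and> conn (F - {{u, w}}) w t)"
    using assms(1) unfolding conn_def[of F]
  proof (induction rule: rtranclp_induct)
    case base
    then show ?case by simp
  next
    case (step t t')
    show ?case
    proof (cases "u = t \<or> u = t'")
      case True
      then show ?thesis using step.hyps conn_refl[of "F - {{u, t'}}" t'] by metis
    next
      case False
      then obtain w where w: "{u, w} \<in> F" "conn (F - {{u, w}}) w t"
        using step.IH by auto
      have "{t, t'} \<in> F - {{u, w}}"
        using step.hyps False by (auto simp: doubleton_eq_iff)
      then show ?thesis using w conn_trans[OF w(2) conn_edge] by blast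
    qed
  qed
  then show thesis using assms(2) that by blast
qed

lemma conn_distinct_path:
  assumes "conn F a b"
  obtains p where "p \<noteq> []" "hd p = a" "last p = b" "distinct p"
    "successively (\<lambda>x y. {x, y} \<in> F) p"
proof -
  have "\<exists>p. p \<noteq> [] \<and> hd p = a \<and> last p = b \<and> distinct p \<and> successively (\<lambda>x y. {x, y} \<in> F) p"
    using assms unfolding conn_def
  proof (induction rule: converse_rtranclp_induct)
    case base
    show ?case by (rule exI[of _ "[b]"]) simp
  next
    case (step a a')
    then obtain p where p: "p \<noteq> []" "hd p = a'" "last p = b" "distinct p"
      "successively (\<lambda>x y. {x, y} \<in> F) p" by blast
    show ?case
    proof (cases "a \<in> set p")
      case True
      \<comment> \<open>The walk returns to \<open>a\<close>: drop the loop \<open>a # xs\<close>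
        and keep the path from the later visit on.\<close>
      then obtain xs ys where "p = xs @ a # ys" by (meson split_list)
      then show ?thesis using p
        by (intro exI[of _ "a # ys"]) (auto simp: successively_append_iff)
    next
      case False
      then show ?thesis using p step.hyps
        by (intro exI[of _ "a # p"]) (auto simp: successively_Cons)
    qed
  qed
  then show thesis using that by blast
qed

text \<open>A path from \<open>a\<close> to \<open>b\<close> avoiding the edge would close up with
  it to a cycle.\<close>

lemma forest_edge_not_conn:
  assumes F: "forest V F" and e: "{a, b} \<in> F"
  shows "\<not> conn (F - {{a, b}}) a b"
proof
  assume "conn (F - {{a, b}}) a b"
  then obtain p where p: "p \<noteq> []" "hd p = a" "last p = b" "distinct p"
    "successively (\<lambda>x y. {x, y} \<in> F - {{a, b}}) p"
    by (rule conn_distinct_path)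
  have "a \<noteq> b" using F e by (force simp: forest_def simple_graph_def)
  have succ: "{p ! i, p ! Suc i} \<in> F" if "Suc i < length p" for i
    using p(5) that by (auto simp: successively_conv_nth)
  \<comment> \<open>One vertex would mean \<open>a = b\<close>; two would make the path use the
    removed edge.\<close>
  have "length p \<ge> 3"
  proof (rule ccontr)
    assume "\<not> length p \<ge> 3"
    then consider y where "p = [y]" | y z where "p = [y, z]"
      using p(1) by (cases p; cases "tl p"; auto simp: Suc_le_eq)
    then show False using p \<open>a \<noteq> b\<close> by cases auto
  qed
  moreover have "{p ! i, p ! (Suc i mod length p)} \<in> F" if "i < length p" for i
  proof (cases "Suc i < length p")
    case True
    then show ?thesis using succ by simp
  next
    case False
    then have "Suc i = length p" using that by simp
    then have "p ! i = b" "p ! (Suc i mod length p) = a"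
      using p(1-3) by (auto simp: last_conv_nth hd_conv_nth simp flip: \<open>Suc i = length p\<close>)
    then show ?thesis using e by (simp add: insert_commute)
  qed
  ultimately have "is_cycle F p" using p(4) by (simp add: is_cycle_def)
  then show False using F by (auto simp: forest_def)
qed

lemma forest_subset: "forest V F \<Longrightarrow> F' \<subseteq> F \<Longrightarrow> forest V F'"
  unfolding forest_def simple_graph_def is_cycle_def by blast

text \<open>Walk around the cycle the other way; after \<open>j\<close> steps the walk is at index
  \<open>(Suc i + j) mod n\<close>.\<close>

lemma cycle_edge_conn:
  assumes c: "is_cycle F c" and i: "i < length c"
  defines "e \<equiv> {c ! i, c ! (Suc i mod length c)}"
  shows "conn (F - {e}) (c ! (Suc i mod length c)) (c ! i)"
proof -
  define n where "n = length c"
  have n: "n \<ge> 3" "i < n" and dist: "distinct c"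
    and E: "\<And>k. k < n \<Longrightarrow> {c ! k, c ! (Suc k mod n)} \<in> F"
    using c i by (auto simp: is_cycle_def n_def)
  have "j < n \<Longrightarrow> conn (F - {e}) (c ! (Suc i mod n)) (c ! ((Suc i + j) mod n))" for j
  proof (induction j)
    case 0
    show ?case by simp
  next
    case (Suc j)
    define k where "k = (Suc i + j) mod n"
    have k: "k < n" "Suc k mod n = (Suc i + Suc j) mod n"
      using n by (auto simp: k_def mod_Suc_eq)
    have kv: "k = (if Suc i + j < n then Suc i + j else Suc i + j - n)"
      using n Suc.prems by (simp add: k_def mod_if)
    \<comment> \<open>Index \<open>i\<close> is reached only at \<open>j = n - 1\<close>, but here
      \<open>Suc j < n\<close>.\<close>
    have "k \<noteq> i" using kv n Suc.prems by (auto split: if_splits)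
    \<comment> \<open>The current edge could also be \<open>e\<close> reversed; that would make
      \<open>n\<close> divide 2, against \<open>n \<ge> 3\<close>.\<close>
    have "\<not> (Suc i mod n = k \<and> Suc k mod n = i)"
      using n k(1) by (auto simp: mod_Suc split: if_splits)
    moreover have "a = b" if "c ! a = c ! b" "a < n" "b < n" for a b
      using that dist by (simp add: nth_eq_iff_index_eq n_def)
    moreover have "Suc k mod n < n" "Suc i mod n < n" using n by simp_all
    ultimately have "{c ! k, c ! (Suc k mod n)} \<noteq> e"
      unfolding e_def n_def[symmetric] doubleton_eq_iff
      using \<open>k \<noteq> i\<close> n(2) k(1) by metis
    then have "conn (F - {e}) (c ! k) (c ! (Suc k mod n))"
      using E[OF k(1)] by (intro conn_edge) auto
    moreover have "conn (F - {e}) (c ! (Suc i mod n)) (c ! k)"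
      unfolding k_def by (rule Suc.IH[OF Suc_lessD[OF Suc.prems]])
    ultimately show ?case unfolding k(2) by (rule conn_trans[rotated])
  qed
  from this[of "n - 1"] have "conn (F - {e}) (c ! (Suc i mod n)) (c ! ((Suc i + (n - 1)) mod n))"
    using n by simp
  moreover have "(Suc i + (n - 1)) mod n = i" using n by simp
  ultimately show ?thesis by (simp only: n_def)
qed

text \<open>A new cycle must use the new edge, and the rest of it would connect \<open>u\<close> and
  \<open>w\<close> within \<open>F\<close>.\<close>

lemma forest_insert:
  assumes F: "forest V F" and uw: "u \<in> V" "w \<in> V" and nc: "\<not> conn F u w"
  shows "forest V (insert {u, w} F)"
proof -
  have "u \<noteq> w" using nc by auto
  then have "simple_graph V (insert {u, w} F)"
    using F uw by (auto simp: forest_def simple_graph_def)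
  moreover have False if c: "is_cycle (insert {u, w} F) c" for c
  proof -
    have "\<not> is_cycle F c" using F by (auto simp: forest_def)
    then obtain i where i: "i < length c" "{c ! i, c ! (Suc i mod length c)} = {u, w}"
      using c unfolding is_cycle_def by blast
    have "conn F (c ! (Suc i mod length c)) (c ! i)"
      using cycle_edge_conn[OF c i(1)] unfolding i(2) by (rule conn_mono) auto
    then show False using i(2) nc conn_sym[of F w u] by (auto simp: doubleton_eq_iff)
  qed
  ultimately show ?thesis by (auto simp: forest_def)
qed

section \<open>Forests separating a set of vertices\<close>

text \<open>Summing \<open>x ^ card F\<close> over this family gives \<open>N S\<close>, over
  \<open>conn_forests\<close> it gives \<open>P w T S\<close>. Phrasing contraction as separation
  keeps all forests in the one graph.\<close>

definition sep_forests :: "'a set \<Rightarrow> 'a set set \<Rightarrow> 'a set \<Rightarrow> 'a set set set" where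
  "sep_forests V E S = {F. F \<subseteq> E \<and> forest V F \<and> (\<forall>s\<in>S. \<forall>t\<in>S. conn F s t \<longrightarrow> s = t)}"

definition conn_forests :: "'a set \<Rightarrow> 'a set set \<Rightarrow> 'a \<Rightarrow> 'a set \<Rightarrow> 'a set \<Rightarrow> 'a set set set" where
  "conn_forests V E w T S = {F \<in> sep_forests V E S. \<exists>t\<in>T. conn F w t}"

lemma sep_forests_insert:
  assumes "u \<notin> S"
  shows "sep_forests V E (insert u S) = sep_forests V E S - conn_forests V E u S S"
proof -
  have "(\<forall>s\<in>insert u S. \<forall>t\<in>insert u S. conn F s t \<longrightarrow> s = t) \<longleftrightarrow>
    (\<forall>s\<in>S. \<forall>t\<in>S. conn F s t \<longrightarrow> s = t) \<and> \<not> (\<exists>t\<in>S. conn F u t)" for F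
    using assms conn_sym[of F] by (metis insert_iff)
  then show ?thesis by (auto simp: sep_forests_def conn_forests_def)
qed

text \<open>The inverse removes the first edge of the path from \<open>u\<close> to
  \<open>T\<close>: this isolates \<open>u\<close> from \<open>S\<close> and leaves \<open>w\<close>
  connected to \<open>T\<close>.\<close>

lemma conn_forests_first_edge:
  assumes G: "simple_graph V E" and TS: "T \<subseteq> S" and u: "u \<notin> S"
  shows "bij_betw (\<lambda>(w, F). insert {u, w} F)
           (SIGMA w:{w. {u, w} \<in> E}. conn_forests V E w T (insert u S))
           (conn_forests V E u T S)"
    (is "bij_betw ?f ?A ?B")
proof (rule bij_betwI')
  have A: "{u, w} \<in> E" "F \<subseteq> E" "forest V F" "\<exists>t\<in>T. conn F w t"
      "\<And>s t. s \<in> S \<Longrightarrow> t \<in> S \<Longrightarrow> conn F s t \<Longrightarrow> s = t"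
      "\<And>s. s \<in> S \<Longrightarrow> \<not> conn F u s" "\<And>s. s \<in> S \<Longrightarrow> \<not> conn F s u"
      "\<not> conn F u w" "{u, w} \<notin> F" if "(w, F) \<in> ?A" for w F
  proof -
    show "{u, w} \<in> E" "F \<subseteq> E" "forest V F" and t: "\<exists>t\<in>T. conn F w t"
      and "\<And>s t. s \<in> S \<Longrightarrow> t \<in> S \<Longrightarrow> conn F s t \<Longrightarrow> s = t"
      and us: "\<And>s. s \<in> S \<Longrightarrow> \<not> conn F u s" and "\<And>s. s \<in> S \<Longrightarrow> \<not> conn F s u"
      using that u unfolding sep_forests_def conn_forests_def by auto
    show "\<not> conn F u w" using t us TS conn_trans by (metis subsetD)
    then show "{u, w} \<notin> F" using conn_edge by metis
  qed
  fix X Y assume XY: "X \<in> ?A" "Y \<in> ?A"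
  show "(?f X = ?f Y) = (X = Y)"
  proof
    assume eq: "?f X = ?f Y"
    obtain w F w' F' where X: "X = (w, F)" and Y: "Y = (w', F')" by fastforce
    note A1 = A[OF XY(1)[unfolded X]] and A2 = A[OF XY(2)[unfolded Y]]
    have eq': "insert {u, w} F = insert {u, w'} F'" using eq X Y by simp
    \<comment> \<open>If one forest arose from two edges at \<open>u\<close>, the connection from
      \<open>w\<close> to \<open>t\<close> in \<open>F\<close> could not use \<open>{u, w'}\<close>,
      as \<open>F\<close> separates \<open>u\<close> from \<open>S\<close>. So it survives in
      \<open>H\<close>, and \<open>F'\<close> connects \<open>u\<close> to \<open>t\<close> through
      \<open>w\<close>, which is excluded.\<close>
    have "w = w'"
    proof (rule ccontr)
      assume "w \<noteq> w'"
      then have ne: "{u, w} \<noteq> {u, w'}" by (auto simp: doubleton_eq_iff)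
      define H where "H = F - {{u, w'}}"
      have F: "F = insert {u, w'} H" and F': "F' = insert {u, w} H"
        using eq' ne A1(9) A2(9) by (auto simp: H_def)
      obtain t t' where t: "t \<in> T" "conn F w t" and t': "t' \<in> T" "conn F' w' t'"
        using A1(4) A2(4) by blast
      have tS: "t \<in> S" "t' \<in> S" using t t' TS by auto
      have uw': "conn F u w'" by (rule conn_edge) (simp add: F)
      have uw: "conn F' u w" by (rule conn_edge) (simp add: F')
      have HF: "\<And>a b. conn H a b \<Longrightarrow> conn F a b" and HF': "\<And>a b. conn H a b \<Longrightarrow> conn F' a b"
        using conn_mono[of H _ _ F] conn_mono[of H _ _ F'] by (auto simp: F F')
      have "conn H w t"
        using conn_insert[of u w' H w t] t(2) A1(6,8) tS uw' HF
        unfolding F[symmetric] by (meson conn_sym conn_trans)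
      then have "conn F' u t" using HF' uw conn_trans by metis
      then show False using A2(6) tS by blast
    qed
    then have "F = F'" using eq' A1(9) A2(9) insert_ident by metis
    then show "X = Y" using X Y \<open>w = w'\<close> by simp
  qed simp
next
  fix X assume X: "X \<in> ?A"
  obtain w F where XwF: "X = (w, F)" by fastforce
  have wF: "X = (w, F)" "{u, w} \<in> E" "F \<subseteq> E" "forest V F" "\<exists>t\<in>T. conn F w t"
    and sep: "\<And>s t. s \<in> insert u S \<Longrightarrow> t \<in> insert u S \<Longrightarrow> conn F s t \<Longrightarrow> s = t"
    using X XwF unfolding sep_forests_def conn_forests_def by blast+
  have "\<not> conn F u w" using wF(5) sep u TS conn_trans
    by (metis insertCI subsetD)
  moreover have "u \<in> V" "w \<in> V" using wF(2) G by (auto simp: simple_graph_def)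
  ultimately have "forest V (insert {u, w} F)" using wF(4) by (intro forest_insert)
  \<comment> \<open>A connection using the new edge would link \<open>s\<close> or \<open>t\<close>
    to \<open>u\<close> already in \<open>F\<close>.\<close>
  moreover have "s = t" if "s \<in> S" "t \<in> S" "conn (insert {u, w} F) s t" for s t
    using conn_insert[OF that(3)] that(1,2) sep u by (metis insertCI)
  moreover have "\<exists>t\<in>T. conn (insert {u, w} F) u t"
    using wF(5) conn_mono[of F _ _ "insert {u, w} F"] conn_edge[of u w "insert {u, w} F"]
    by (metis conn_trans insertI1 subset_insertI)
  ultimately show "?f X \<in> ?B" using wF by (auto simp: sep_forests_def conn_forests_def)
next
  fix F assume "F \<in> ?B"
  then obtain t where F: "F \<subseteq> E" "forest V F" "t \<in> T" "conn F u t"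
    and sep: "\<And>s t. s \<in> S \<Longrightarrow> t \<in> S \<Longrightarrow> conn F s t \<Longrightarrow> s = t"
    by (auto simp: sep_forests_def conn_forests_def)
  have tS: "t \<in> S" and "u \<noteq> t" using F(3) TS u by auto
  then obtain w where w: "{u, w} \<in> F" "conn (F - {{u, w}}) w t"
    using conn_first_edge F(4) by metis
  define F' where "F' = F - {{u, w}}"
  have F'F: "\<And>a b. conn F' a b \<Longrightarrow> conn F a b"
    using conn_mono[of F' _ _ F] by (auto simp: F'_def)
  have nuw: "\<not> conn F' u w" unfolding F'_def by (rule forest_edge_not_conn[OF F(2) w(1)])
  \<comment> \<open>In \<open>F\<close>, \<open>u\<close> reaches only \<open>t\<close> among
    \<open>S\<close>; reaching \<open>t\<close> in \<open>F'\<close> too would connect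
    \<open>u\<close> to \<open>w\<close> without their edge.\<close>
  have us: "\<not> conn F' u s" if "s \<in> S" for s
  proof
    assume us: "conn F' u s"
    then have "s = t" using sep that tS F(4) F'F conn_sym conn_trans by metis
    then show False using us w(2) nuw conn_sym conn_trans by (metis F'_def)
  qed
  then have "s = t" if "s \<in> insert u S" "t \<in> insert u S" "conn F' s t" for s t
    using that sep F'F conn_sym[of F'] by (metis insert_iff)
  moreover have "forest V F'" "F' \<subseteq> E"
    using forest_subset[OF F(2), of F'] F(1) by (auto simp: F'_def)
  ultimately have "F' \<in> conn_forests V E w T (insert u S)"
    using F(3) w(2) by (auto simp: sep_forests_def conn_forests_def F'_def)
  then have "(w, F') \<in> ?A" using w(1) F(1) by auto
  moreover have "F = ?f (w, F')" using w(1) by (auto simp: F'_def)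
  ultimately show "\<exists>X\<in>?A. F = ?f X" by blast
qed

section \<open>Finiteness, neighbour counts and generating functions\<close>

lemma simple_graph_finite_edges: "simple_graph V E \<Longrightarrow> finite E"
  unfolding simple_graph_def by (meson Pow_iff finite_Pow_iff finite_subset subsetI)

lemma finite_sep_forests:
  assumes "simple_graph V E"
  shows "finite (sep_forests V E S)" "finite (conn_forests V E w T S)"
proof -
  show "finite (sep_forests V E S)"
    by (rule finite_subset[of _ "Pow E"])
      (auto simp: sep_forests_def simple_graph_finite_edges[OF assms])
  then show "finite (conn_forests V E w T S)" by (simp add: conn_forests_def)
qed

lemma neighbours:
  assumes "simple_graph V E"
  shows "finite {w. {u, w} \<in> E}" "card {w. {u, w} \<in> E} \<le> degree E u"
proof -
  have fin: "finite {e \<in> E. u \<in> e}" using simple_graph_finite_edges[OF assms] by simp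
  have inj: "inj_on (\<lambda>w. {u, w}) {w. {u, w} \<in> E}" by (auto simp: inj_on_def doubleton_eq_iff)
  have sub: "(\<lambda>w. {u, w}) ` {w. {u, w} \<in> E} \<subseteq> {e \<in> E. u \<in> e}" by auto
  show "finite {w. {u, w} \<in> E}" using finite_subset[OF sub fin] inj finite_image_iff by blast
  show "card {w. {u, w} \<in> E} \<le> degree E u"
    unfolding degree_def by (rule card_inj_on_le[OF inj sub fin])
qed

lemma sum_conn_forests_first_edge:
  fixes x :: complex
  assumes G: "simple_graph V E" and TS: "T \<subseteq> S" and u: "u \<notin> S"
  shows "(\<Sum>F\<in>conn_forests V E u T S. x ^ card F) =
    x * (\<Sum>w | {u, w} \<in> E. \<Sum>F\<in>conn_forests V E w T (insert u S). x ^ card F)"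
proof -
  let ?A = "SIGMA w:{w. {u, w} \<in> E}. conn_forests V E w T (insert u S)"
  have "(\<Sum>F\<in>conn_forests V E u T S. x ^ card F) = (\<Sum>(w, F)\<in>?A. x ^ card (insert {u, w} F))"
    using sum.reindex_bij_betw[OF conn_forests_first_edge[OF assms], of "\<lambda>F. x ^ card F"]
    by (simp add: case_prod_unfold)
  also have "\<dots> = (\<Sum>(w, F)\<in>?A. x * x ^ card F)"
  proof (rule sum.cong[OF refl], clarify)
    fix w F assume F: "F \<in> conn_forests V E w T (insert u S)"
    then have "F \<subseteq> E" by (auto simp: conn_forests_def sep_forests_def)
    then have "finite F" using simple_graph_finite_edges[OF G] finite_subset by blast
    \<comment> \<open>The edge is new, so the cardinality grows by exactly one; this is the factor
      \<open>x\<close>.\<close>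
    moreover have "{u, w} \<notin> F"
    proof
      assume "{u, w} \<in> F"
      moreover obtain t where "t \<in> T" "conn F w t" using F by (auto simp: conn_forests_def)
      ultimately have "conn F u t" "t \<in> S" using conn_edge conn_trans TS by (metis, auto)
      then show False using F u by (auto simp: conn_forests_def sep_forests_def)
    qed
    ultimately show "x ^ card (insert {u, w} F) = x * x ^ card F" by simp
  qed
  also have "\<dots> = (\<Sum>w | {u, w} \<in> E. \<Sum>F\<in>conn_forests V E w T (insert u S). x * x ^ card F)"
    by (rule sum.Sigma[symmetric]) (auto simp: neighbours[OF G] finite_sep_forests[OF G])
  finally show ?thesis by (simp add: sum_distrib_left)
qed

text \<open>Everything is contracted: any edge would join two vertices to be separated, so
  \<open>N V = 1\<close>.\<close>

lemma sep_forests_all: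
  assumes G: "simple_graph V E"
  shows "sep_forests V E V = {{}}"
proof -
  have "F = {}" if "F \<in> sep_forests V E V" for F
  proof (rule ccontr)
    assume "F \<noteq> {}"
    then obtain e where e: "e \<in> F" by blast
    have "e \<subseteq> V" "card e = 2"
      using that e by (auto simp: sep_forests_def forest_def simple_graph_def)
    then obtain a b where ab: "e = {a, b}" "a \<noteq> b" "a \<in> V" "b \<in> V"
      by (auto simp: card_2_iff)
    then show False using that e conn_edge[of a b F] by (auto simp: sep_forests_def)
  qed
  moreover have "{} \<in> sep_forests V E V"
  proof -
    have "a = b" if "conn {} a b" for a b :: 'a
      using that unfolding conn_def by (induction rule: rtranclp_induct) auto
    moreover have "\<not> is_cycle {} c" for c :: "'a list"
      unfolding is_cycle_def by (cases c) auto
    ultimately show ?thesis using G by (auto simp: sep_forests_def forest_def simple_graph_def)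
  qed
  ultimately show ?thesis by blast
qed

text \<open>\<open>T\<close> is kept apart from \<open>S\<close> because the first-edge identity
  enlarges \<open>S\<close> while \<open>T\<close> stays fixed. Only vertices outside
  \<open>S\<close> are expanded, so the degree bound is asked only there.\<close>

lemma conn_forests_le_sep_forests:
  fixes x :: complex
  assumes G: "simple_graph V E" and deg: "\<forall>u\<in>V - S. degree E u \<le> \<Delta>"
    and x: "real \<Delta> * norm x \<le> 1 / 2" and S: "S \<subseteq> V"
  defines "N \<equiv> \<lambda>S. \<Sum>F\<in>sep_forests V E S. x ^ card F"
    and "P \<equiv> \<lambda>w T S. \<Sum>F\<in>conn_forests V E w T S. x ^ card F"
  shows "N S \<noteq> 0 \<and> (\<forall>T\<subseteq>S. \<forall>w\<in>V. norm (P w T S) \<le> norm (N S))"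
  using S deg
proof (induction "card (V - S)" arbitrary: S rule: less_induct)
  case less
  have step: "norm (P u T S) \<le> norm (N (insert u S)) / 2 \<and> N (insert u S) \<noteq> 0"
    if u: "u \<in> V - S" and T: "T \<subseteq> S" for u T
  proof -
    have "card (V - insert u S) < card (V - S)"
      using u G by (intro psubset_card_mono) (auto simp: simple_graph_def)
    then have IH: "N (insert u S) \<noteq> 0"
      "\<And>w. w \<in> V \<Longrightarrow> norm (P w T (insert u S)) \<le> norm (N (insert u S))"
      using less.hyps[of "insert u S"] less.prems u T by (auto simp: subset_insertI2)
    have "norm (\<Sum>w | {u, w} \<in> E. P w T (insert u S))
        \<le> real (card {w. {u, w} \<in> E}) * norm (N (insert u S))"
      using G IH(2) by (intro sum_norm_bound) (auto simp: simple_graph_def)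
    also have "\<dots> \<le> real \<Delta> * norm (N (insert u S))"
      using neighbours(2)[OF G, of u] less.prems u
      by (intro mult_right_mono) (auto intro: order_trans)
    finally have "norm (P u T S) \<le> norm x * (real \<Delta> * norm (N (insert u S)))"
      using sum_conn_forests_first_edge[OF G T, of u x] u
      by (simp add: P_def norm_mult mult_left_mono)
    also have "\<dots> = (real \<Delta> * norm x) * norm (N (insert u S))" by simp
    also have "\<dots> \<le> 1 / 2 * norm (N (insert u S))"
      using x by (intro mult_right_mono) auto
    finally show ?thesis using IH(1) by simp
  qed
  have half: "norm (N S) \<ge> norm (N (insert u S)) / 2" if u: "u \<in> V - S" for u
  proof -
    have "N (insert u S) = N S - P u S S"
      unfolding N_def P_def using u
      by (subst sep_forests_insert) (auto simp: sum_diff finite_sep_forests[OF G] conn_forests_def)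
    then have "norm (N (insert u S)) \<le> norm (N S) + norm (P u S S)"
      by (simp add: norm_triangle_ineq4)
    then show ?thesis using step[OF u subset_refl] by simp
  qed
  have "N S \<noteq> 0"
  proof (cases "S = V")
    case True
    then show ?thesis by (simp add: N_def sep_forests_all[OF G])
  next
    case False
    then obtain u where "u \<in> V - S" using less.prems by blast
    then show ?thesis using half[of u] step[of u S] by auto
  qed
  moreover have "norm (P w T S) \<le> norm (N S)" if T: "T \<subseteq> S" and w: "w \<in> V" for T w
  proof -
    \<comment> \<open>A neighbour produced by the first-edge identity may lie anywhere. In
      \<open>T\<close> it gives \<open>P = N\<close>; in \<open>S - T\<close> separation gives
      \<open>P = 0\<close>.\<close>
    consider "w \<in> V - S" | "w \<in> T" | "w \<in> S - T" using w by blast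
    then show ?thesis
    proof cases
      case 1
      then show ?thesis using step[OF _ T] half order_trans by blast
    next
      case 2
      then have "conn_forests V E w T S = sep_forests V E S"
        by (auto simp: conn_forests_def intro: bexI[of _ w])
      then show ?thesis by (simp add: P_def N_def)
    next
      case 3
      then have "conn_forests V E w T S = {}"
        using T by (fastforce simp: conn_forests_def sep_forests_def)
      then show ?thesis by (simp add: P_def)
    qed
  qed
  ultimately show ?case by blast
qed

theorem theorem1p3:
  fixes V :: "'a set" and E :: "'a set set" and v :: 'a and \<Delta> :: nat and x :: complex
  assumes "simple_graph V E"
    and "v \<in> V"
    and "\<Delta> > 0"
    and "\<forall>u \<in> V - {v}. degree E u \<le> \<Delta>"
    and "norm x \<le> 1 / (2 * real \<Delta>)"
  shows "forest_gf V E x \<noteq> 0"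
proof -
  have "real \<Delta> * norm x \<le> 1 / 2" using assms(3,5) by (simp add: field_simps)
  \<comment> \<open>Separating a single vertex is no restriction, so \<open>S = {v}\<close> counts
    all forests and leaves the degree of \<open>v\<close> free.\<close>
  moreover have "forest_gf V E x = (\<Sum>F\<in>sep_forests V E {v}. x ^ card F)"
    by (simp add: forest_gf_def sep_forests_def)
  ultimately show ?thesis
    using conn_forests_le_sep_forests[of V E "{v}" \<Delta> x] assms by simp
qed

end
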